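(* Let $p\in\mathbb{C}[z_1,z_2]$ be a complex bivariate polynomial. The imaginary projection $\mathcal{I}(p)$ is $\mathbb{R}^2$ if $p$ has a factor $q$ such that the total degree of $q$ is odd and the initial form of $q$ has no real roots in $\mathbb{P}^1$.
   Context: For $p\in\mathbb{C}[z_1,\dots,z_n]$ with complex variety $\mathcal{V}(p)=\{\mathbf{z}\in\mathbb{C}^n : p(\mathbf{z})=0\}$, the imaginary projection is $\mathcal{I}(p)=\{(\operatorname{Im} z_1,\dots,\operatorname{Im} z_n) : \mathbf{z}\in\mathcal{V}(p)\}\subseteq\mathbb{R}^n$. The initial form of a polynomial is the sum of its terms of maximal total degree. For $n=2$, a root of the initial form in $\mathbb{P}^1$ (complex projective line) is a point $(z_1:z_2)$ where it vanishes; it is real if it lies in $\mathbb{P}^1_{\mathbb{R}}$. *)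

theory Defs
  imports Complex_Main "HOL-Computational_Algebra.Polynomial"
begin

text \<open>
  The ring of complex polynomials in the variables \<open>z1\<close>, \<open>z2\<close> is represented by the type
  \<open>complex poly poly\<close>: the outer variable is \<open>z1\<close>, the inner one is \<open>z2\<close>, so that
  \<open>coeff (coeff p i) j\<close> is the coefficient of the monomial \<open>z1 ^ i * z2 ^ j\<close>.
\<close>

definition eval2 :: "complex poly poly \<Rightarrow> complex \<Rightarrow> complex \<Rightarrow> complex" where
  "eval2 p z1 z2 = poly (poly p [:z1:]) z2"

lemma eval2_altdef:
  "eval2 p z1 z2 = (\<Sum>i\<le>degree p. \<Sum>j\<le>degree (coeff p i). coeff (coeff p i) j * z1 ^ i * z2 ^ j)"
proof -
  have "eval2 p z1 z2 = (\<Sum>i\<le>degree p. poly (coeff p i) z2 * z1 ^ i)"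
    by (simp add: eval2_def poly_altdef[of p] poly_sum)
  also have "\<dots> = (\<Sum>i\<le>degree p. \<Sum>j\<le>degree (coeff p i). coeff (coeff p i) j * z1 ^ i * z2 ^ j)"
    by (simp add: poly_altdef sum_distrib_right sum_distrib_left mult_ac)
  finally show ?thesis .
qed

definition variety :: "complex poly poly \<Rightarrow> (complex \<times> complex) set" where
  "variety p = {(z1, z2). eval2 p z1 z2 = 0}"

definition imaginary_projection :: "complex poly poly \<Rightarrow> (real \<times> real) set" where
  "imaginary_projection p = (\<lambda>(z1, z2). (Im z1, Im z2)) ` variety p"

definition support2 :: "complex poly poly \<Rightarrow> (nat \<times> nat) set" where
  "support2 p = {(i, j). coeff (coeff p i) j \<noteq> 0}"

lemma finite_support2: "finite (support2 p)"
proof (rule finite_subset)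
  show "support2 p \<subseteq> (SIGMA i:{..degree p}. {..degree (coeff p i)})"
    by (auto simp: support2_def intro!: le_degree)
qed auto

text \<open>The total degree of the zero polynomial is \<open>0\<close>, as for \<^const>\<open>degree\<close>.\<close>

definition total_degree :: "complex poly poly \<Rightarrow> nat" where
  "total_degree p = (if p = 0 then 0 else Max {i + j | i j. (i, j) \<in> support2 p})"

definition initial_form :: "complex poly poly \<Rightarrow> complex poly poly" where
  "initial_form p =
     (\<Sum>(i, j) \<in> {(i, j) \<in> support2 p. i + j = total_degree p}.
        monom (monom (coeff (coeff p i) j) j) i)"

text \<open>
  Points of the complex projective line are given by homogeneous coordinates \<open>(z1 : z2)\<close>, not both
  zero and determined up to a common nonzero complex factor. Such a point lies in the real
  projective line iff some choice of its homogeneous coordinates is real.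
\<close>

definition projective_root :: "complex poly poly \<Rightarrow> complex \<Rightarrow> complex \<Rightarrow> bool" where
  "projective_root f z1 z2 \<longleftrightarrow> (z1, z2) \<noteq> (0, 0) \<and> eval2 f z1 z2 = 0"

definition real_projective_point :: "complex \<Rightarrow> complex \<Rightarrow> bool" where
  "real_projective_point z1 z2 \<longleftrightarrow>
     (z1, z2) \<noteq> (0, 0) \<and> (\<exists>c. c \<noteq> 0 \<and> c * z1 \<in> \<real> \<and> c * z2 \<in> \<real>)"

end

theory Submission
  imports Defs "HOL-Analysis.Further_Topology"
begin

text \<open>
  Let \<open>q\<close> be the given factor, \<open>d\<close> its degree and \<open>h\<close> its initial form, and fix the imaginary
  parts \<open>y\<close>. If \<open>F x = q (x + \<i> y)\<close> had no zero on the real plane, then \<open>s ^ d * F (v / s)\<close> with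
  \<open>s = 1 - \<bar>v\<bar>\<close> would be a nonvanishing function on the open unit disc. It extends continuously
  by \<open>h\<close> to the unit circle, where it is nonvanishing too, and odd because \<open>d\<close> is odd. But a
  continuous function on the closed disc that is odd on the boundary has a zero.
\<close>

text \<open>A zero-free \<open>f\<close> would have a continuous logarithm \<open>g\<close> on the
  disc. On the circle, oddness of \<open>f\<close> makes \<open>exp (g (- z) - g z)\<close> equal to
  -1, while \<open>g (- z) - g z\<close> changes sign under \<open>z\<close> to \<open>- z\<close>,
  so its imaginary part must vanish somewhere.\<close>

lemma odd_on_circle_imp_zero:
  fixes f :: "complex \<Rightarrow> complex"
  assumes cont: "continuous_on (cball 0 1) f"
    and odd: "\<And>z. cmod z = 1 \<Longrightarrow> f (- z) = - f z"
  obtains z where "z \<in> cball 0 1" "f z = 0"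
proof (rule ccontr)
  assume "\<not> thesis"
  with that have nz: "\<And>z. z \<in> cball 0 1 \<Longrightarrow> f z \<noteq> 0"
    by blast
  obtain g where g: "continuous_on (cball 0 1) g"
    and fg: "\<And>z. z \<in> cball 0 1 \<Longrightarrow> f z = exp (g z)"
    using continuous_logarithm_on_cball[OF cont nz] by blast
  define D where "D t = g (- cis t) - g (cis t)" for t
  have cont_D: "continuous_on {0..pi} (\<lambda>t. Im (D t))"
    unfolding D_def
    by (intro continuous_intros continuous_on_compose2[OF g]) auto
  have exp_D: "exp (D t) = - 1" for t
  proof -
    have "exp (D t) = f (- cis t) / f (cis t)"
      by (simp add: D_def exp_diff fg)
    then show ?thesis
      using odd[of "cis t"] nz[of "cis t"] by simp
  qed
  \<comment> \<open>Half a turn swaps the two antipodal arguments of \<open>g\<close>, so the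
    intermediate value theorem applies on \<open>{0..pi}\<close>.\<close>
  have D_pi: "Im (D pi) = - Im (D 0)"
    by (simp add: D_def)
  obtain t where "Im (D t) = 0"
  proof (cases "Im (D 0) \<le> 0")
    case True
    then show ?thesis
      using IVT'[of "\<lambda>t. Im (D t)" 0 0 pi] cont_D D_pi that by auto
  next
    case False
    then show ?thesis
      using IVT2'[of "\<lambda>t. Im (D t)" pi 0 0] cont_D D_pi that by auto
  qed
  \<comment> \<open>A real exponent has a positive exponential, which cannot be -1.\<close>
  then have "Re (exp (D t)) = exp (Re (D t))"
    by (simp add: Re_exp)
  with exp_D[of t] have "exp (Re (D t)) = - 1"
    by simp
  then show False
    by (metis exp_gt_zero neg_0_less_iff_less not_one_less_zero)
qed

lemma eval2_mult: "eval2 (p * q) z1 z2 = eval2 p z1 z2 * eval2 q z1 z2"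
  by (simp add: eval2_def)

lemma eval2_sum: "eval2 (\<Sum>x\<in>A. f x) z1 z2 = (\<Sum>x\<in>A. eval2 (f x) z1 z2)"
  by (simp add: eval2_def poly_sum)

lemma eval2_monom: "eval2 (monom (monom c j) i) z1 z2 = c * z1 ^ i * z2 ^ j"
  by (simp add: eval2_def poly_monom)

text \<open>Indexing by the support turns the initial form into a subsum, and every index then obeys
  the degree bound.\<close>

lemma eval2_support2:
  "eval2 p z1 z2 = (\<Sum>(i, j)\<in>support2 p. coeff (coeff p i) j * z1 ^ i * z2 ^ j)"
proof -
  have "eval2 p z1 z2 = (\<Sum>(i, j)\<in>(SIGMA i:{..degree p}. {..degree (coeff p i)}).
      coeff (coeff p i) j * z1 ^ i * z2 ^ j)"
    by (simp add: eval2_altdef sum.Sigma)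
  also have "\<dots> = (\<Sum>(i, j)\<in>support2 p. coeff (coeff p i) j * z1 ^ i * z2 ^ j)"
    by (rule sum.mono_neutral_right) (auto simp: support2_def intro!: le_degree)
  finally show ?thesis .
qed

lemma eval2_initial_form:
  "eval2 (initial_form p) z1 z2 =
    (\<Sum>(i, j)\<in>{(i, j) \<in> support2 p. i + j = total_degree p}. coeff (coeff p i) j * z1 ^ i * z2 ^ j)"
  by (simp add: initial_form_def eval2_sum eval2_monom case_prod_unfold)

lemma support2_le_total_degree:
  assumes "(i, j) \<in> support2 p"
  shows "i + j \<le> total_degree p"
proof -
  have "{i + j | i j. (i, j) \<in> support2 p} = (\<lambda>(i, j). i + j) ` support2 p"
    by force
  then have "finite {i + j | i j. (i, j) \<in> support2 p}"
    by (simp add: finite_support2)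
  moreover have "p \<noteq> 0"
    using assms by (auto simp: support2_def)
  ultimately show ?thesis
    using assms by (auto simp: total_degree_def intro!: Max_ge)
qed

lemma eval2_zero_prescribed_Im:
  assumes odd_deg: "odd (total_degree q)"
    and no_root: "\<And>a b :: real. (a, b) \<noteq> (0, 0) \<Longrightarrow>
      eval2 (initial_form q) (of_real a) (of_real b) \<noteq> 0"
  obtains z1 z2 where "eval2 q z1 z2 = 0" "Im z1 = y1" "Im z2 = y2"
proof -
  define d where "d = total_degree q"
  define s where "s v = complex_of_real (1 - cmod v)" for v
  \<comment> \<open>The rescaled function with its denominators cleared term by term, so that
    continuity up to \<open>s v = 0\<close> is evident.\<close>
  define K where "K v = (\<Sum>(i, j)\<in>support2 q. coeff (coeff q i) j *
      (of_real (Re v) + s v * (\<i> * of_real y1)) ^ i *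
      (of_real (Im v) + s v * (\<i> * of_real y2)) ^ j * s v ^ (d - (i + j)))" for v
  have cont: "continuous_on (cball 0 1) K"
    unfolding K_def s_def case_prod_unfold by (intro continuous_intros)
  have K_sphere: "K v = eval2 (initial_form q) (of_real (Re v)) (of_real (Im v))"
    if "cmod v = 1" for v
  proof -
    \<comment> \<open>Here \<open>s v = 0\<close>, and since \<open>0 ^ 0 = 1\<close> exactly the
      terms of top degree survive.\<close>
    have "K v = (\<Sum>(i, j)\<in>support2 q. if i + j = d
        then coeff (coeff q i) j * of_real (Re v) ^ i * of_real (Im v) ^ j else 0)"
      unfolding K_def using that
      by (intro sum.cong)
        (auto simp: s_def d_def power_0_left dest: support2_le_total_degree)
    also have "\<dots> = (\<Sum>(i, j)\<in>{(i, j) \<in> support2 q. i + j = d}.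
        coeff (coeff q i) j * of_real (Re v) ^ i * of_real (Im v) ^ j)"
      by (rule sum.mono_neutral_cong_right) (auto simp: finite_support2 split: if_splits)
    finally show ?thesis
      by (simp add: eval2_initial_form d_def)
  qed
  have K_odd: "K (- v) = - K v" if "cmod v = 1" for v
  proof -
    \<comment> \<open>An odd sum means that exactly one of \<open>i\<close> and \<open>j\<close> is
      odd.\<close>
    have "(- a) ^ i * (- b) ^ j = - (a ^ i * b ^ j)"
      if "i + j = total_degree q" for a b :: complex and i j
      using odd_deg unfolding that[symmetric] by (auto simp: power_minus_odd)
    then show ?thesis
      using that
      by (auto simp: K_sphere eval2_initial_form mult.assoc simp flip: sum_negf intro!: sum.cong)
  qed
  obtain v where v: "v \<in> cball 0 1" "K v = 0"
    using odd_on_circle_imp_zero[OF cont K_odd] by blast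
  have "cmod v \<noteq> 1"
  proof
    assume "cmod v = 1"
    then have "(Re v, Im v) \<noteq> (0, 0)"
      by (auto simp: cmod_def)
    with no_root K_sphere[OF \<open>cmod v = 1\<close>] v show False
      by metis
  qed
  with v have s: "s v \<noteq> 0"
    by (simp add: s_def)
  \<comment> \<open>Since \<open>s v\<close> is real, dividing by it changes only the real parts;
    the imaginary parts stay \<open>y1\<close> and \<open>y2\<close>.\<close>
  define z1 where "z1 = of_real (Re v) / s v + \<i> * of_real y1"
  define z2 where "z2 = of_real (Im v) / s v + \<i> * of_real y2"
  have sz: "of_real (Re v) + s v * (\<i> * of_real y1) = s v * z1"
    "of_real (Im v) + s v * (\<i> * of_real y2) = s v * z2"
    using s by (simp_all add: z1_def z2_def distrib_left)
  have "K v = (\<Sum>(i, j)\<in>support2 q. s v ^ d * (coeff (coeff q i) j * z1 ^ i * z2 ^ j))"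
    unfolding K_def sz
  proof (intro sum.cong refl, clarify)
    fix i j assume "(i, j) \<in> support2 q"
    \<comment> \<open>The degree bound keeps the natural subtraction from truncating.\<close>
    then have "s v ^ d = s v ^ i * s v ^ j * s v ^ (d - (i + j))"
      using support2_le_total_degree by (simp add: d_def flip: power_add)
    then show "coeff (coeff q i) j * (s v * z1) ^ i * (s v * z2) ^ j * s v ^ (d - (i + j)) =
        s v ^ d * (coeff (coeff q i) j * z1 ^ i * z2 ^ j)"
      by (simp add: power_mult_distrib)
  qed
  also have "\<dots> = s v ^ d * eval2 q z1 z2"
    by (simp add: eval2_support2 sum_distrib_left case_prod_unfold)
  finally have "eval2 q z1 z2 = 0"
    using v s by simp
  moreover have "Im z1 = y1" "Im z2 = y2"
    by (simp_all add: z1_def z2_def s_def flip: of_real_divide)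
  ultimately show thesis
    using that by blast
qed

theorem corollary3p5:
  fixes p :: "complex poly poly"
  assumes "\<exists>q. q dvd p \<and> odd (total_degree q) \<and>
    \<not> (\<exists>z1 z2. projective_root (initial_form q) z1 z2 \<and> real_projective_point z1 z2)"
  shows "imaginary_projection p = UNIV"
proof -
  obtain q r where p: "p = q * r" and odd_deg: "odd (total_degree q)"
    and no_root: "\<And>z1 z2. \<not> (projective_root (initial_form q) z1 z2 \<and> real_projective_point z1 z2)"
    using assms by (auto elim!: dvdE)
  have nz: "eval2 (initial_form q) (of_real a) (of_real b) \<noteq> 0" if "(a, b) \<noteq> (0, 0)" for a b :: real
  proof -
    have "real_projective_point (of_real a) (of_real b)"
      using that by (auto simp: real_projective_point_def intro!: exI[of _ 1])
    then show ?thesis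
      using no_root[of "of_real a" "of_real b"] that by (auto simp: projective_root_def)
  qed
  have "(y1, y2) \<in> imaginary_projection p" for y1 y2
  proof -
    obtain z1 z2 where "eval2 q z1 z2 = 0" "Im z1 = y1" "Im z2 = y2"
      using eval2_zero_prescribed_Im[OF odd_deg nz] by blast
    then show ?thesis
      by (force simp: imaginary_projection_def variety_def p eval2_mult)
  qed
  then show ?thesis
    by auto
qed

end
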